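(* Let $(\mathfrak m,V,\omega,B_\mu)$ be a special symplectic representation over $k$ and let $A\in V\setminus\{0\}$. Then the subspace $\mathfrak m\cdot A=\{m\cdot A: m\in\mathfrak m\}$ of $V$ is coisotropic, i.e. $(\mathfrak m\cdot A)^\perp\subseteq\mathfrak m\cdot A$, where $\perp$ denotes the orthogonal with respect to $\omega$.
   Context: $k$ is a field of characteristic not $2$ or $3$. A special symplectic representation (SSR) $(\mathfrak m,V,\omega,B_\mu)$ over $k$ is a faithful representation of a Lie algebra $\mathfrak m$ over $k$ on a symplectic vector space $(V,\omega)$ ($\omega$ a nondegenerate alternating bilinear form), together with an $\mathfrak m$-equivariant symmetric bilinear map $B_\mu:V\times V\to\mathfrak m$ (equivariance: $[m,B_\mu(A,B)]=B_\mu(m\cdot A,B)+B_\mu(A,m\cdot B)$), such that for all $m\in\mathfrak m$ and $A,B,C\in V$: $$\omega(m\cdot A,B)+\omega(A,m\cdot B)=0,$$ $$2B_\mu(A,B)\cdot C-2B_\mu(A,C)\cdot B=2\omega(B,C)A-\omega(A,B)C+\omega(A,C)B.$$ *)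

theory Defs
  imports Complex_Main "HOL-Computational_Algebra.Primes"
begin

text \<open>
  A vector space over a field is given by a type of class \<open>ab_group_add\<close> together with a scalar
  multiplication, as in the library locale \<open>vector_space\<close>. Nothing is assumed to be
  finite-dimensional.
\<close>

locale bilinear_map =
  fixes s1 :: "'k::field \<Rightarrow> 'a::ab_group_add \<Rightarrow> 'a"
    and s2 :: "'k \<Rightarrow> 'b::ab_group_add \<Rightarrow> 'b"
    and s3 :: "'k \<Rightarrow> 'c::ab_group_add \<Rightarrow> 'c"
    and f :: "'a \<Rightarrow> 'b \<Rightarrow> 'c"
  assumes linear_left: "Vector_Spaces.linear s1 s3 (\<lambda>x. f x y)"
    and linear_right: "Vector_Spaces.linear s2 s3 (\<lambda>y. f x y)"

locale lie_algebra = vector_space scale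
  for scale :: "'k::field \<Rightarrow> 'm::ab_group_add \<Rightarrow> 'm" +
  fixes bracket :: "'m \<Rightarrow> 'm \<Rightarrow> 'm"
  assumes bracket_bilinear: "bilinear_map scale scale scale bracket"
    and bracket_alternating: "bracket x x = 0"
    and jacobi: "bracket x (bracket y z) + bracket y (bracket z x) + bracket z (bracket x y) = 0"

locale lie_representation =
  lie_algebra scale_m bracket + V: vector_space scale_V
  for scale_m :: "'k::field \<Rightarrow> 'm::ab_group_add \<Rightarrow> 'm"
    and bracket :: "'m \<Rightarrow> 'm \<Rightarrow> 'm"
    and scale_V :: "'k \<Rightarrow> 'v::ab_group_add \<Rightarrow> 'v" +
  fixes act :: "'m \<Rightarrow> 'v \<Rightarrow> 'v"
  assumes act_bilinear: "bilinear_map scale_m scale_V scale_V act"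
    and act_bracket: "act (bracket m n) v = act m (act n v) - act n (act m v)"

locale faithful_lie_representation = lie_representation +
  assumes faithful: "inj act"

locale symplectic_vector_space = vector_space scale
  for scale :: "'k::field \<Rightarrow> 'v::ab_group_add \<Rightarrow> 'v" +
  fixes \<omega> :: "'v \<Rightarrow> 'v \<Rightarrow> 'k"
  assumes form_bilinear: "bilinear_map scale scale (*) \<omega>"
    and form_alternating: "\<omega> v v = 0"
    and form_nondegenerate: "(\<And>w. \<omega> v w = 0) \<Longrightarrow> v = 0"
begin

definition orthogonal :: "'v set \<Rightarrow> 'v set" where
  "orthogonal W = {v. \<forall>w\<in>W. \<omega> v w = 0}"

definition coisotropic :: "'v set \<Rightarrow> bool" where
  "coisotropic W \<longleftrightarrow> subspace W \<and> orthogonal W \<subseteq> W"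

end

locale special_symplectic_representation =
  faithful_lie_representation scale_m bracket scale_V act + symplectic_vector_space scale_V \<omega>
  for scale_m :: "'k::field \<Rightarrow> 'm::ab_group_add \<Rightarrow> 'm"
    and bracket :: "'m \<Rightarrow> 'm \<Rightarrow> 'm"
    and scale_V :: "'k \<Rightarrow> 'v::ab_group_add \<Rightarrow> 'v"
    and act :: "'m \<Rightarrow> 'v \<Rightarrow> 'v"
    and \<omega> :: "'v \<Rightarrow> 'v \<Rightarrow> 'k" +
  fixes B :: "'v \<Rightarrow> 'v \<Rightarrow> 'm"
  assumes B_bilinear: "bilinear_map scale_V scale_V scale_m B"
    and B_symmetric: "B x y = B y x"
    and B_equivariant: "bracket m (B x y) = B (act m x) y + B x (act m y)"
    and form_invariant: "\<omega> (act m x) y + \<omega> x (act m y) = 0"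
    and special:
      "scale_V 2 (act (B x y) z) - scale_V 2 (act (B x z) y) =
        scale_V (2 * \<omega> y z) x - scale_V (\<omega> x y) z + scale_V (\<omega> x z) y"

end

theory Submission
  imports Defs
begin

text \<open>
  Two facts carry the proof. The first is a reciprocity law,
  \<open>\<omega>(B(x,y)z, w) = \<omega>(B(z,w)x, y)\<close>, which stands in for an invariant bilinear form on the Lie
  algebra: it says that a vector \<open>C\<close> orthogonal to \<open>\<mm>\<cdot>A\<close> satisfies \<open>B(A,C) = 0\<close>, because then
  \<open>B(A,C)\<close> acts by zero and the representation is faithful.

  The second is what remains of the special identity when \<open>B(A,C) = 0\<close>: for every \<open>P\<close>,
  \<open>2\<omega>(A,P)C + \<omega>(A,C)P + \<omega>(C,P)A = -2B(C,P)\<cdot>A\<close>, an element of \<open>\<mm>\<cdot>A\<close>.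
  Varying \<open>P\<close> isolates \<open>C\<close>. The choice \<open>P = C\<close> gives \<open>3\<omega>(A,C)C\<close>, which settles the case
  \<open>\<omega>(A,C) \<noteq> 0\<close>. If \<open>\<omega>(A,C) = 0\<close>, the middle term vanishes, and since \<open>\<omega>(A,P) \<noteq> 0\<close> for some \<open>P\<close>,
  it is enough that \<open>A \<in> \<mm>\<cdot>A\<close>. Otherwise the relation forces \<open>\<omega>(C,-)\<close> to vanish wherever
  \<open>\<omega>(A,-)\<close> does, so \<open>C\<close> is a multiple of \<open>A\<close>, and the relation reads
  \<open>3\<omega>(A,P)C \<in> \<mm>\<cdot>A\<close>.
\<close>

lemma of_nat_prime_neq_0:
  assumes "prime p" and "CHAR('a::semiring_1) \<noteq> p"
  shows "of_nat p \<noteq> (0::'a)"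
  using assms CHAR_not_1[where ?'a = 'a]
  by (auto simp: of_nat_eq_0_iff_char_dvd prime_nat_iff)

context symplectic_vector_space
begin

lemma form_linear:
  "\<omega> (x + y) z = \<omega> x z + \<omega> y z" "\<omega> x (y + z) = \<omega> x y + \<omega> x z"
  "\<omega> (x - y) z = \<omega> x z - \<omega> y z" "\<omega> x (y - z) = \<omega> x y - \<omega> x z"
  "\<omega> (scale c x) y = c * \<omega> x y" "\<omega> x (scale c y) = c * \<omega> x y"
proof -
  interpret L: Vector_Spaces.linear scale "(*)" "\<lambda>x. \<omega> x u" for u
    using form_bilinear by (simp add: bilinear_map_def)
  interpret R: Vector_Spaces.linear scale "(*)" "\<omega> u" for u
    using form_bilinear by (simp add: bilinear_map_def)
  show "\<omega> (x + y) z = \<omega> x z + \<omega> y z" "\<omega> x (y + z) = \<omega> x y + \<omega> x z"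
    "\<omega> (x - y) z = \<omega> x z - \<omega> y z" "\<omega> x (y - z) = \<omega> x y - \<omega> x z"
    "\<omega> (scale c x) y = c * \<omega> x y" "\<omega> x (scale c y) = c * \<omega> x y"
    by (simp_all add: L.add R.add L.diff R.diff L.scale R.scale)
qed

lemma form_antisym: "\<omega> x y = - \<omega> y x"
  using form_alternating[of "x + y", unfolded form_linear]
  by (simp add: form_alternating eq_neg_iff_add_eq_0 add.commute)

end

context lie_representation
begin

lemma orbit_subspace: "V.subspace {act m v | m. True}"
proof -
  interpret L: Vector_Spaces.linear scale_m scale_V "\<lambda>m. act m v"
    using act_bilinear by (simp add: bilinear_map_def)
  have "{act m v | m. True} = range (\<lambda>m. act m v)" by auto
  then show ?thesis using L.subspace_image[OF subspace_UNIV] by simp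
qed

lemma act_zero_left: "act 0 v = 0"
proof -
  interpret L: Vector_Spaces.linear scale_m scale_V "\<lambda>m. act m v"
    using act_bilinear by (simp add: bilinear_map_def)
  show ?thesis by (rule L.zero)
qed

end

context special_symplectic_representation
begin

text \<open>
  The special identity rewrites \<open>B(x,y)z\<close> through \<open>B(x,z)y\<close>; invariance of the form moves \<open>y\<close> to
  the other slot; a second use of the special identity turns \<open>B(x,z)w\<close> into \<open>B(z,w)x\<close>. The terms
  without \<open>B\<close> produced on the way cancel.
\<close>
lemma form_B_reciprocity:
  assumes "(2::'k) \<noteq> 0"
  shows "\<omega> (act (B x y) z) w = \<omega> (act (B z w) x) y"
proof -
  have 1: "2 * \<omega> (act (B x y) z) w - 2 * \<omega> (act (B x z) y) w =
      2 * \<omega> y z * \<omega> x w - \<omega> x y * \<omega> z w + \<omega> x z * \<omega> y w"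
    using arg_cong[OF special[of x y z], of "\<lambda>v. \<omega> v w"] by (simp add: form_linear)
  have 2: "2 * \<omega> (act (B z x) w) y - 2 * \<omega> (act (B z w) x) y =
      2 * \<omega> x w * \<omega> z y - \<omega> z x * \<omega> w y + \<omega> z w * \<omega> x y"
    using arg_cong[OF special[of z x w], of "\<lambda>v. \<omega> v y"] by (simp add: form_linear)
  have 3: "\<omega> (act (B x z) y) w = \<omega> (act (B z x) w) y"
    using form_invariant[of "B x z" y w] form_antisym[of y "act (B x z) w"] B_symmetric[of x z]
    by simp
  have "2 * \<omega> (act (B x y) z) w = 2 * \<omega> (act (B z w) x) y"
    using 1 2 unfolding 3 form_antisym[of z y] form_antisym[of z x] form_antisym[of w y]
    by (simp add: algebra_simps)
  then show ?thesis using assms by simp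
qed

lemma B_eq_0_if_orthogonal:
  assumes "(2::'k) \<noteq> 0" and "C \<in> orthogonal {act m A | m. True}"
  shows "B A C = 0"
proof -
  have "\<omega> (act (B A C) z) w = 0" for z w
    using assms(2) form_antisym[of "act (B z w) A" C]
    by (auto simp: form_B_reciprocity[OF assms(1)] orthogonal_def)
  then have "act (B A C) = act 0"
    using form_nondegenerate by (auto simp: act_zero_left)
  then show ?thesis using faithful by (simp add: inj_eq)
qed

lemma isolating_relation:
  assumes "B A C = 0"
  shows "scale_V (2 * \<omega> A P) C + scale_V (\<omega> A C) P + scale_V (\<omega> C P) A \<in> {act m A | m. True}"
proof -
  have "scale_V (2 * \<omega> A P) C + scale_V (\<omega> A C) P + scale_V (\<omega> C P) A =
      scale_V (- 2) (act (B C P) A)"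
    using special[of C A P] assms B_symmetric[of C A] form_antisym[of C A]
    by (simp add: act_zero_left algebra_simps)
  also have "\<dots> \<in> {act m A | m. True}"
    by (rule V.subspace_scale[OF orbit_subspace]) blast
  finally show ?thesis .
qed

lemma orthogonal_orbit_subset:
  assumes "(2::'k) \<noteq> 0" and "(3::'k) \<noteq> 0" and "A \<noteq> 0"
  shows "orthogonal {act m A | m. True} \<subseteq> {act m A | m. True}"
proof
  define W where "W = {act m A | m. True}"
  have W: "V.subspace W" unfolding W_def by (rule orbit_subspace)
  have cancel: "v \<in> W" if "scale_V c v \<in> W" "c \<noteq> 0" for c v
    using V.subspace_scale[OF W that(1), of "inverse c"] that(2) by simp
  fix C assume "C \<in> orthogonal {act m A | m. True}"
  then have "B A C = 0" by (rule B_eq_0_if_orthogonal[OF assms(1)])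
  note rel = isolating_relation[OF this, folded W_def]
  have "C \<in> W"
  proof (cases "\<omega> A C = 0")
    case False
    have "scale_V (3 * \<omega> A C) C \<in> W"
      using rel[of C] by (simp add: form_alternating flip: V.scale_left_distrib)
    then show ?thesis using False assms(2) by (auto intro: cancel)
  next
    case True
    then have rel: "scale_V (2 * \<omega> A P) C + scale_V (\<omega> C P) A \<in> W" for P
      using rel[of P] by simp
    obtain P where P: "\<omega> A P \<noteq> 0" using form_nondegenerate assms(3) by blast
    show ?thesis
    proof (cases "A \<in> W")
      case True
      then have "scale_V (2 * \<omega> A P) C \<in> W"
        using V.subspace_diff[OF W rel[of P] V.subspace_scale[OF W True, of "\<omega> C P"]] by simp
      then show ?thesis using P assms(1) by (auto intro: cancel)
    next
      case False
      have ker: "\<omega> C Q = 0" if "\<omega> A Q = 0" for Q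
        using rel[of Q] that cancel False by auto
      define c where "c = \<omega> C P / \<omega> A P"
      \<comment> \<open>Subtracting the right multiple of \<open>P\<close> from \<open>Q\<close> puts it in the kernel of \<open>\<omega>(A,-)\<close>.\<close>
      have "\<omega> (C - scale_V c A) Q = 0" for Q
        using ker[of "Q - scale_V (\<omega> A Q / \<omega> A P) P"] P
        by (simp add: form_linear c_def field_simps)
      then have C: "C = scale_V c A" using form_nondegenerate by force
      have "scale_V (3 * \<omega> A P) C = scale_V (2 * \<omega> A P) C + scale_V (\<omega> C P) A"
        unfolding C by (simp add: form_linear algebra_simps flip: V.scale_left_distrib)
      then have "scale_V (3 * \<omega> A P) C \<in> W" using rel[of P] by simp
      then show ?thesis using P assms(2) by (auto intro: cancel)
    qed
  qed
  then show "C \<in> {act m A | m. True}" by (simp add: W_def)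
qed

end

theorem theorem3p1:
  fixes scale_m :: "'k::field \<Rightarrow> 'm::ab_group_add \<Rightarrow> 'm"
    and bracket :: "'m \<Rightarrow> 'm \<Rightarrow> 'm"
    and scale_V :: "'k \<Rightarrow> 'v::ab_group_add \<Rightarrow> 'v"
    and act :: "'m \<Rightarrow> 'v \<Rightarrow> 'v"
    and \<omega> :: "'v \<Rightarrow> 'v \<Rightarrow> 'k"
    and B :: "'v \<Rightarrow> 'v \<Rightarrow> 'm"
    and A :: 'v
  assumes "CHAR('k) \<noteq> 2" and "CHAR('k) \<noteq> 3"
    and "special_symplectic_representation scale_m bracket scale_V act \<omega> B"
    and "A \<noteq> 0"
  shows "symplectic_vector_space.coisotropic scale_V \<omega> {act m A | m. True}"
proof -
  interpret special_symplectic_representation scale_m bracket scale_V act \<omega> B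
    by (rule assms(3))
  have "(2::'k) \<noteq> 0" and "(3::'k) \<noteq> 0"
    using of_nat_prime_neq_0[OF _ assms(1)] of_nat_prime_neq_0[OF _ assms(2)] by simp_all
  then show ?thesis
    using orthogonal_orbit_subset assms(4) orbit_subspace by (simp add: coisotropic_def)
qed

end
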